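(* Let $Z$ be a topological space and let $Y$ be a $Z$-corecompact space. Then the topology $t^Z_{1}$ on $C(Y,Z)$ is admissible.
   Context: For a topological space $X$, $\mathcal{O}(X)$ denotes the family of all open subsets of $X$. $C(Y,Z)$ is the set of all continuous maps from $Y$ to $Z$, and $\mathcal{O}_Z(Y)=\{f^{-1}(U): f\in C(Y,Z),\ U\in\mathcal{O}(Z)\}$. $\tau_Y^Z$ is the topology on $Y$ having $\mathcal{O}_Z(Y)$ as a subbasis. A subset $K$ of a space $X$ is bounded (in $X$) if every open cover of $X$ has a finite subcollection covering $K$. The space $Y$ is $Z$-corecompact if for every $y\in Y$ and every open neighborhood $U$ of $y$ in $Y$ there is a neighborhood $f^{-1}(V)\in\mathcal{O}_Z(Y)$ of $y$ such that $f^{-1}(V)\subseteq U$ and $f^{-1}(V)$ is $Z$-bounded in the space $U$, meaning that $f^{-1}(V)$ is bounded in $U$ when $U$ carries the topology $\{U\cap W: W\in\tau_Y^Z\}$ (the subspace topology from $(Y,\tau_Y^Z)$). $\tau_1^Z$ is the family of all $\mathbb{H}\subseteq\mathcal{O}(Y)$ such that: ($\alpha$) if $A\in\mathbb{H}\cap\mathcal{O}_Z(Y)$, $V\in\mathcal{O}(Y)$ and $A\subseteq V$, then $V\in\mathbb{H}$; and ($\beta$) every collection of elements of $\mathcal{O}_Z(Y)$ whose union belongs to $\mathbb{H}$ has a finite subcollection whose union belongs to $\mathbb{H}$. The topology $t_1^Z$ on $C(Y,Z)$ has as a subbasis all sets $(\mathbb{H},U)=\{f\in C(Y,Z): f^{-1}(U)\in\mathbb{H}\}$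 with $\mathbb{H}\in\tau_1^Z$ and $U\in\mathcal{O}(Z)$. A topology $t$ on $C(Y,Z)$ is admissible if for every space $X$ and every map $G:X\to C(Y,Z)$, continuity of $G:X\to (C(Y,Z),t)$ implies continuity of $\widetilde{G}:X\times Y\to Z$, $\widetilde{G}(x,y)=G(x)(y)$; equivalently, the evaluation map $e:(C(Y,Z),t)\times Y\to Z$, $e(f,y)=f(y)$, is continuous. *)

theory Defs
  imports "HOL-Analysis.Analysis"
begin

text \<open>
  Topological spaces are the abstract topologies of the library, so that the empty space and
  spaces that are not a whole type are included. Maps out of \<open>topspace Y\<close> are represented
  by functions that are \<open>undefined\<close> outside \<open>topspace Y\<close>; this makes equality of
  functions coincide with equality of maps.
\<close>

definition cont_maps :: "'a topology \<Rightarrow> 'b topology \<Rightarrow> ('a \<Rightarrow> 'b) set" where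
  "cont_maps Y Z = {f \<in> extensional (topspace Y). continuous_map Y Z f}"

definition preim :: "'a topology \<Rightarrow> ('a \<Rightarrow> 'b) \<Rightarrow> 'b set \<Rightarrow> 'a set" where
  "preim Y f U = {y \<in> topspace Y. f y \<in> U}"

text \<open>Taking finite intersections relative to \<open>S\<close> makes the empty intersection equal to
  \<open>S\<close>, so the carrier is always \<open>S\<close>, even if the members of the family do not
  cover it.\<close>

definition subbasis_topology :: "'a set \<Rightarrow> 'a set set \<Rightarrow> 'a topology" where
  "subbasis_topology S \<B> =
     topology (arbitrary union_of (finite intersection_of (\<lambda>B. B \<in> \<B>) relative_to S))"

definition opens_via :: "'b topology \<Rightarrow> 'a topology \<Rightarrow> 'a set set" where
  "opens_via Z Y = {preim Y f U | f U. f \<in> cont_maps Y Z \<and> openin Z U}"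

definition tau_via :: "'b topology \<Rightarrow> 'a topology \<Rightarrow> 'a topology" where
  "tau_via Z Y = subbasis_topology (topspace Y) (opens_via Z Y)"

definition bounded_in :: "'a topology \<Rightarrow> 'a set \<Rightarrow> bool" where
  "bounded_in X K \<longleftrightarrow> K \<subseteq> topspace X \<and>
     (\<forall>\<U>. (\<forall>U\<in>\<U>. openin X U) \<and> \<Union>\<U> = topspace X \<longrightarrow>
          (\<exists>\<F>. finite \<F> \<and> \<F> \<subseteq> \<U> \<and> K \<subseteq> \<Union>\<F>))"

definition corecompact_via :: "'b topology \<Rightarrow> 'a topology \<Rightarrow> bool" where
  "corecompact_via Z Y \<longleftrightarrow>
     (\<forall>y U. openin Y U \<and> y \<in> U \<longrightarrow>
        (\<exists>B \<in> opens_via Z Y. y \<in> B \<and> B \<subseteq> U \<and> bounded_in (subtopology (tau_via Z Y) U) B))"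

definition tau1 :: "'b topology \<Rightarrow> 'a topology \<Rightarrow> 'a set set set" where
  "tau1 Z Y = {\<H>. (\<forall>V\<in>\<H>. openin Y V) \<and>
     (\<forall>A V. A \<in> \<H> \<inter> opens_via Z Y \<and> openin Y V \<and> A \<subseteq> V \<longrightarrow> V \<in> \<H>) \<and>
     (\<forall>\<A>. \<A> \<subseteq> opens_via Z Y \<and> \<Union>\<A> \<in> \<H> \<longrightarrow>
          (\<exists>\<F>. finite \<F> \<and> \<F> \<subseteq> \<A> \<and> \<Union>\<F> \<in> \<H>))}"

definition t1 :: "'b topology \<Rightarrow> 'a topology \<Rightarrow> ('a \<Rightarrow> 'b) topology" where
  "t1 Z Y = subbasis_topology (cont_maps Y Z)
     {{f \<in> cont_maps Y Z. preim Y f U \<in> \<H>} | \<H> U. \<H> \<in> tau1 Z Y \<and> openin Z U}"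

text \<open>HOL cannot quantify over types inside a formula, so the type of the points of the test
  spaces \<open>X\<close> is a parameter. A theorem with a free type variable in that place covers all
  spaces \<open>X\<close>; \<open>admissible_iff_eval\<close> below shows that the type of maps alone
  already suffices.\<close>

definition admissible ::
  "'x itself \<Rightarrow> 'a topology \<Rightarrow> 'b topology \<Rightarrow> ('a \<Rightarrow> 'b) topology \<Rightarrow> bool" where
  "admissible _ Y Z t \<longleftrightarrow> topspace t = cont_maps Y Z \<and>
     (\<forall>(X::'x topology) G. continuous_map X t G \<longrightarrow>
        continuous_map (prod_topology X Y) Z (\<lambda>(x, y). G x y))"

lemma eval_imp_admissible:
  assumes "topspace t = cont_maps Y Z"
    and "continuous_map (prod_topology t Y) Z (\<lambda>(f, y). f y)"
  shows "admissible TYPE('x) Y Z t"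
  unfolding admissible_def
proof (intro conjI allI impI)
  fix X :: "'x topology" and G
  assume G: "continuous_map X t G"
  have "continuous_map (prod_topology X Y) (prod_topology t Y) (\<lambda>(x, y). (G x, y))"
    using G continuous_map_fst continuous_map_snd
    by (auto simp: case_prod_unfold continuous_map_pairwise o_def
        intro: continuous_map_compose[unfolded o_def])
  from continuous_map_compose[OF this assms(2)]
  show "continuous_map (prod_topology X Y) Z (\<lambda>(x, y). G x y)"
    by (simp add: o_def case_prod_unfold)
qed (rule assms(1))

lemma admissible_iff_eval:
  fixes Y :: "'a topology" and Z :: "'b topology"
  shows "admissible TYPE('a \<Rightarrow> 'b) Y Z t \<longleftrightarrow>
    topspace t = cont_maps Y Z \<and> continuous_map (prod_topology t Y) Z (\<lambda>(f, y). f y)"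
proof
  assume adm: "admissible TYPE('a \<Rightarrow> 'b) Y Z t"
  have "continuous_map t t (\<lambda>f. f)"
    by simp
  with adm show "topspace t = cont_maps Y Z \<and> continuous_map (prod_topology t Y) Z (\<lambda>(f, y). f y)"
    unfolding admissible_def by blast
qed (blast intro: eval_imp_admissible)

end

theory Submission
  imports Defs
begin

text \<open>
  Given \<open>f y \<in> W\<close>, corecompactness yields a neighbourhood \<open>B\<close> of \<open>y\<close> that is bounded in the
  preimage of \<open>W\<close>. The family \<open>\<H>\<close> of all open \<open>V\<close> in which \<open>B\<close> is bounded belongs to \<open>\<tau>\<^sub>1\<close>: if \<open>B\<close>
  is bounded in \<open>\<Union>\<A>\<close>, cover \<open>\<Union>\<A>\<close> by sets each of which is bounded in a member of \<open>\<A>\<close>;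
  finitely many of them cover \<open>B\<close>, so \<open>B\<close> is bounded in the union of finitely many members of \<open>\<A>\<close>.
  Evaluation then maps \<open>(\<H>, W) \<times> B\<close> into \<open>W\<close>.
\<close>

lemma topspace_subbasis_topology [simp]: "topspace (subbasis_topology S \<B>) = S"
  by (simp add: subbasis_topology_def topspace_subbase)

lemma openin_subbasis_topology:
  assumes "B \<in> \<B>" "B \<subseteq> S"
  shows "openin (subbasis_topology S \<B>) B"
proof -
  \<comment> \<open>\<open>relative_to S\<close> turns \<open>B\<close> into
    \<open>S \<inter> B\<close>; the inclusion \<open>B \<subseteq> S\<close> is what gives back
    \<open>B\<close> itself.\<close>
  have "(finite intersection_of (\<lambda>B. B \<in> \<B>) relative_to S) (S \<inter> B)"
    using assms(1) by (intro relative_to_inc finite_intersection_of_inc)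
  moreover have "S \<inter> B = B"
    using assms(2) by blast
  ultimately show ?thesis
    by (simp add: subbasis_topology_def openin_subbase arbitrary_union_of_inc)
qed

lemma openin_preim:
  assumes "f \<in> cont_maps Y Z" "openin Z U"
  shows "openin Y (preim Y f U)"
  using assms by (auto simp: cont_maps_def preim_def continuous_map_def)

lemma openin_opens_via: "B \<in> opens_via Z Y \<Longrightarrow> openin Y B"
  by (auto simp: opens_via_def openin_preim)

lemma topspace_tau_via [simp]: "topspace (tau_via Z Y) = topspace Y"
  by (simp add: tau_via_def)

lemma openin_tau_via: "B \<in> opens_via Z Y \<Longrightarrow> openin (tau_via Z Y) B"
  unfolding tau_via_def
  by (intro openin_subbasis_topology) (auto dest: openin_opens_via openin_subset)

lemma bounded_in_subset: "bounded_in X K \<Longrightarrow> K \<subseteq> topspace X"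
  by (simp add: bounded_in_def)

lemma bounded_inE:
  assumes "bounded_in X K" "\<And>U. U \<in> \<U> \<Longrightarrow> openin X U" "\<Union>\<U> = topspace X"
  obtains \<F> where "finite \<F>" "\<F> \<subseteq> \<U>" "K \<subseteq> \<Union>\<F>"
proof -
  have "(\<forall>U\<in>\<U>. openin X U) \<and> \<Union>\<U> = topspace X"
    using assms(2,3) by simp
  then have "\<exists>\<F>. finite \<F> \<and> \<F> \<subseteq> \<U> \<and> K \<subseteq> \<Union>\<F>"
    by (rule assms(1)[unfolded bounded_in_def, THEN conjunct2, THEN spec, THEN mp])
  with that show thesis
    by (elim exE conjE)
qed

text \<open>Given an open cover, choose a finite subfamily for each of the finitely many
  \<open>K\<close>; together these subfamilies are still finite and cover \<open>B\<close>.\<close>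

lemma bounded_in_Union:
  assumes "finite \<K>" "\<And>K. K \<in> \<K> \<Longrightarrow> bounded_in X K" "B \<subseteq> \<Union>\<K>"
  shows "bounded_in X B"
  unfolding bounded_in_def
proof (intro conjI allI impI)
  show "B \<subseteq> topspace X"
    using assms(2,3) bounded_in_subset by blast
next
  fix \<U> assume "(\<forall>U\<in>\<U>. openin X U) \<and> \<Union>\<U> = topspace X"
  then have "\<forall>K\<in>\<K>. \<exists>\<F>. finite \<F> \<and> \<F> \<subseteq> \<U> \<and> K \<subseteq> \<Union>\<F>"
    by (meson assms(2) bounded_inE)
  then obtain F where F: "\<And>K. K \<in> \<K> \<Longrightarrow> finite (F K) \<and> F K \<subseteq> \<U> \<and> K \<subseteq> \<Union>(F K)"
    by metis
  have "finite (\<Union>(F ` \<K>))"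
    using F assms(1) by simp
  moreover have "\<Union>(F ` \<K>) \<subseteq> \<U>"
    using F by blast
  moreover have "B \<subseteq> \<Union>(\<Union>(F ` \<K>))"
  proof
    fix x assume "x \<in> B"
    then obtain K where "K \<in> \<K>" "x \<in> K"
      using assms(3) by blast
    moreover from this have "x \<in> \<Union>(F K)"
      using F by (meson subsetD)
    ultimately show "x \<in> \<Union>(\<Union>(F ` \<K>))"
      by blast
  qed
  ultimately show "\<exists>\<F>. finite \<F> \<and> \<F> \<subseteq> \<U> \<and> B \<subseteq> \<Union>\<F>"
    by blast
qed

text \<open>The traces on \<open>A\<close> of an open cover of the larger space form an open cover
  of the smaller one, and a finite family of traces covering \<open>B\<close> lifts back to members
  of the original cover.\<close>

lemma bounded_in_subtopology_mono:
  assumes "bounded_in (subtopology T A) B" "A \<subseteq> V"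
  shows "bounded_in (subtopology T V) B"
  unfolding bounded_in_def
proof (intro conjI allI impI)
  show "B \<subseteq> topspace (subtopology T V)"
    using bounded_in_subset[OF assms(1)] assms(2) by auto
next
  fix \<U> assume \<U>: "(\<forall>U\<in>\<U>. openin (subtopology T V) U) \<and> \<Union>\<U> = topspace (subtopology T V)"
  have "openin (subtopology T A) (U \<inter> A)" if "U \<in> \<U>" for U
  proof -
    have "openin (subtopology T V) U"
      using \<U> that by simp
    then obtain W where "openin T W" "U = W \<inter> V"
      unfolding openin_subtopology by blast
    \<comment> \<open>Since \<open>A \<subseteq> V\<close>, the trace
      \<open>W \<inter> V \<inter> A\<close> equals \<open>W \<inter> A\<close>, so the same
      \<open>W\<close> witnesses openness.\<close>
    then show ?thesis
      using assms(2) by (auto simp: openin_subtopology intro!: exI[of _ W])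
  qed
  then have "openin (subtopology T A) C" if "C \<in> (\<lambda>U. U \<inter> A) ` \<U>" for C
    using that by blast
  moreover have "\<Union>((\<lambda>U. U \<inter> A) ` \<U>) = topspace (subtopology T A)"
  proof -
    have "\<Union>((\<lambda>U. U \<inter> A) ` \<U>) = \<Union>\<U> \<inter> A"
      by blast
    also have "\<dots> = topspace T \<inter> V \<inter> A"
      using \<U> by simp
    also have "\<dots> = topspace (subtopology T A)"
      using assms(2) by auto
    finally show ?thesis .
  qed
  ultimately obtain \<G> where \<G>: "finite \<G>" "\<G> \<subseteq> (\<lambda>U. U \<inter> A) ` \<U>" "B \<subseteq> \<Union>\<G>"
    using bounded_inE[OF assms(1)] by metis
  \<comment> \<open>One cover member is picked for each trace in \<open>\<G>\<close>, which keeps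
    the family finite.\<close>
  then obtain \<F> where \<F>: "finite \<F>" "\<F> \<subseteq> \<U>" "\<G> = (\<lambda>U. U \<inter> A) ` \<F>"
    by (meson finite_subset_image)
  have "\<Union>\<G> \<subseteq> \<Union>\<F>"
    unfolding \<F>(3) by blast
  with \<G>(3) have "B \<subseteq> \<Union>\<F>"
    by (rule subset_trans)
  with \<F>(1,2) show "\<exists>\<F>. finite \<F> \<and> \<F> \<subseteq> \<U> \<and> B \<subseteq> \<Union>\<F>"
    by blast
qed

text \<open>Condition (\<alpha>) is monotonicity of boundedness in the ambient set; corecompactness
  enters only in condition (\<beta>).\<close>

lemma bounded_family_in_tau1:
  assumes Y: "corecompact_via Z Y"
  shows "{V. openin Y V \<and> bounded_in (subtopology (tau_via Z Y) V) B} \<in> tau1 Z Y"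
    (is "?\<H> \<in> _")
  unfolding tau1_def
proof (rule CollectI, intro conjI allI impI)
  show "\<forall>V\<in>?\<H>. openin Y V"
    by blast
next
  fix A V assume "A \<in> ?\<H> \<inter> opens_via Z Y \<and> openin Y V \<and> A \<subseteq> V"
  then show "V \<in> ?\<H>"
    by (auto intro: bounded_in_subtopology_mono)
next
  fix \<A> assume \<A>: "\<A> \<subseteq> opens_via Z Y \<and> \<Union>\<A> \<in> ?\<H>"
  \<comment> \<open>Corecompactness puts such a \<open>C\<close> around every point of every
    \<open>A \<in> \<A>\<close>, so \<open>\<U>\<close> covers \<open>\<Union>\<A>\<close>. Taking
    \<open>C\<close> from \<open>opens_via Z Y\<close> makes it open in \<open>tau_via Z Y\<close>,
    the topology in which boundedness of \<open>B\<close> is measured.\<close>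
  define \<U> where "\<U> = {C \<in> opens_via Z Y. \<exists>A\<in>\<A>. C \<subseteq> A \<and> bounded_in (subtopology (tau_via Z Y) A) C}"
  have "openin (subtopology (tau_via Z Y) (\<Union>\<A>)) C" if "C \<in> \<U>" for C
  proof -
    have "openin (tau_via Z Y) C" "C \<subseteq> \<Union>\<A>"
      using that openin_tau_via unfolding \<U>_def by blast+
    then show ?thesis
      by (simp add: openin_subtopology) blast
  qed
  moreover have "\<Union>\<U> = topspace (subtopology (tau_via Z Y) (\<Union>\<A>))"
  proof -
    have "x \<in> \<Union>\<U>" if x: "x \<in> A" "A \<in> \<A>" for x A
    proof -
      have "openin Y A"
        using \<A> x openin_opens_via by blast
      then obtain C where "C \<in> opens_via Z Y" "x \<in> C" "C \<subseteq> A"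
        "bounded_in (subtopology (tau_via Z Y) A) C"
        using Y x unfolding corecompact_via_def by metis
      with x show ?thesis
        unfolding \<U>_def by blast
    qed
    then have "\<Union>\<U> = \<Union>\<A>"
      unfolding \<U>_def by blast
    moreover have "\<Union>\<A> \<subseteq> topspace Y"
      using \<A> openin_subset by blast
    ultimately show ?thesis
      by auto
  qed
  moreover have "bounded_in (subtopology (tau_via Z Y) (\<Union>\<A>)) B"
    using \<A> by blast
  ultimately obtain \<K> where \<K>: "finite \<K>" "\<K> \<subseteq> \<U>" "B \<subseteq> \<Union>\<K>"
    by (metis bounded_inE)
  then have "\<forall>C\<in>\<K>. \<exists>A\<in>\<A>. bounded_in (subtopology (tau_via Z Y) A) C"
    unfolding \<U>_def by blast
  then obtain a where a: "\<And>C. C \<in> \<K> \<Longrightarrow> a C \<in> \<A> \<and> bounded_in (subtopology (tau_via Z Y) (a C)) C"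
    by metis
  have "bounded_in (subtopology (tau_via Z Y) (\<Union>(a ` \<K>))) B"
    using \<K>(1) _ \<K>(3)
  proof (rule bounded_in_Union)
    fix C assume "C \<in> \<K>"
    with a show "bounded_in (subtopology (tau_via Z Y) (\<Union>(a ` \<K>))) C"
      by (blast intro: bounded_in_subtopology_mono)
  qed
  moreover have "openin Y (\<Union>(a ` \<K>))"
    using a \<A> openin_opens_via by blast
  ultimately show "\<exists>\<F>. finite \<F> \<and> \<F> \<subseteq> \<A> \<and> \<Union>\<F> \<in> ?\<H>"
    using \<K>(1) a by (intro exI[of _ "a ` \<K>"]) auto
qed

lemma topspace_t1 [simp]: "topspace (t1 Z Y) = cont_maps Y Z"
  by (simp add: t1_def)

lemma openin_t1:
  assumes "\<H> \<in> tau1 Z Y" "openin Z U"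
  shows "openin (t1 Z Y) {f \<in> cont_maps Y Z. preim Y f U \<in> \<H>}"
  unfolding t1_def using assms by (intro openin_subbasis_topology) auto

lemma continuous_map_eval_t1:
  assumes Y: "corecompact_via Z Y"
  shows "continuous_map (prod_topology (t1 Z Y) Y) Z (\<lambda>(f, y). f y)"
proof -
  have "openin (prod_topology (t1 Z Y) Y)
          {p \<in> topspace (prod_topology (t1 Z Y) Y). (\<lambda>(f, y). f y) p \<in> W}" (is "openin _ ?S")
    if W: "openin Z W" for W
    unfolding openin_prod_topology_alt
  proof (intro allI impI)
    fix f y assume "(f, y) \<in> ?S"
    then have f: "f \<in> cont_maps Y Z" and y: "y \<in> preim Y f W"
      by (auto simp: preim_def)
    then obtain B where B: "B \<in> opens_via Z Y" "y \<in> B"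
      "bounded_in (subtopology (tau_via Z Y) (preim Y f W)) B"
      using Y openin_preim[OF f W] unfolding corecompact_via_def by metis
    \<comment> \<open>This choice makes \<open>\<N>\<close> a subbasic open set of
      \<open>t1 Z Y\<close>; it contains \<open>f\<close> because \<open>B\<close> is bounded in
      \<open>preim Y f W\<close>.\<close>
    define \<H> where "\<H> = {V. openin Y V \<and> bounded_in (subtopology (tau_via Z Y) V) B}"
    define \<N> where "\<N> = {g \<in> cont_maps Y Z. preim Y g W \<in> \<H>}"
    have "openin (t1 Z Y) \<N>"
      unfolding \<N>_def \<H>_def by (intro openin_t1 bounded_family_in_tau1 Y W)
    moreover have "openin Y B"
      using B(1) by (rule openin_opens_via)
    moreover have "f \<in> \<N>"
      using f B(3) openin_preim[OF f W] by (simp add: \<N>_def \<H>_def)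
    moreover have "(g, x) \<in> ?S" if g: "g \<in> \<N>" and "x \<in> B" for g x
    proof -
      \<comment> \<open>Boundedness includes containment in the carrier, so membership of
        \<open>preim Y g W\<close> in \<open>\<H>\<close> forces
        \<open>B \<subseteq> preim Y g W\<close>.\<close>
      have "x \<in> preim Y g W"
        using that bounded_in_subset unfolding \<N>_def \<H>_def by fastforce
      with g show ?thesis
        by (simp add: \<N>_def preim_def)
    qed
    ultimately show "\<exists>U V. openin (t1 Z Y) U \<and> openin Y V \<and> f \<in> U \<and> y \<in> V \<and> U \<times> V \<subseteq> ?S"
      using B(2) by (intro exI[of _ \<N>] exI[of _ B]) blast
  qed
  moreover have "(\<lambda>(f, y). f y) \<in> topspace (prod_topology (t1 Z Y) Y) \<rightarrow> topspace Z"
    by (auto simp: cont_maps_def continuous_map_def)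
  ultimately show ?thesis
    unfolding continuous_map_def by blast
qed

text \<open>Continuity of evaluation suffices for test spaces over any type \<open>'x\<close>, as
  the map \<open>(x, y) \<mapsto> G x y\<close> is evaluation after
  \<open>(x, y) \<mapsto> (G x, y)\<close>.\<close>

theorem theorem2p9:
  fixes Y :: "'a topology" and Z :: "'b topology"
  assumes "corecompact_via Z Y"
  shows "admissible TYPE('x) Y Z (t1 Z Y)"
  using topspace_t1 continuous_map_eval_t1[OF assms] by (rule eval_imp_admissible)

end
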